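(* Let $(\mathcal{X},\mathcal{A},L)$ be a basic game, $t:\mathcal{X}\to\mathbb{R}^k$ a statistic with $T=t(X)$, and, for $\tau\in\mathbb{R}^k$, $\Gamma_\tau:=\{P\in\mathcal{P}:E_P(T)=\tau\}$. Let $\tau\in\mathcal{T}$ be linear, with associated linear pair $(P_\tau,\zeta_\tau)$ and linear coefficients $(\beta_0,\beta)\in\mathbb{R}\times\mathbb{R}^k$; that is, $P_\tau\in\Gamma_\tau$, $\zeta_\tau\in\mathcal{Z}$ is a Bayes act against $P_\tau$, and $L(x,\zeta_\tau)=\beta_0+\beta^{\mathrm T}t(x)$ for all $x\in\mathcal{X}$. Then the following hold: (i) $\zeta_\tau$ is an equalizer rule against $\Gamma_\tau$; (ii) $(P_\tau,\zeta_\tau)$ is a saddle-point in $\mathcal{G}^\tau=(\Gamma_\tau,\mathcal{A},L)$; (iii) $\zeta_\tau$ is robust Bayes against $\Gamma_\tau$; (iv) $h(\tau)=H(P_\tau)=\beta_0+\beta^{\mathrm T}\tau$; (v) $\tau\leftrightarrow\beta$.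
   Context: A basic game $(\mathcal{X},\mathcal{A},L)$ consists of measurable spaces $\mathcal{X}$ and $\mathcal{A}$ (with $\sigma$-fields containing all singletons) and a jointly measurable loss function $L:\mathcal{X}\times\mathcal{A}\to(-\infty,\infty]$. Expectations are taken in the extended sense $E f=E f^+-E f^-$, defined unless both terms are infinite. $L(P,a):=E_P\{L(X,a)\}$, and $\mathcal{P}$ is the set of all probability distributions $P$ on $\mathcal{X}$ such that $L(P,a)$ is defined for all $a\in\mathcal{A}$. For a randomized act $\zeta$ (a probability distribution on $\mathcal{A}$), $L(x,\zeta):=E_{A\sim\zeta}\{L(x,A)\}$ and $L(P,\zeta):=E_{(X,A)\sim P\times\zeta}\{L(X,A)\}$; $\mathcal{Z}$ is the set of all $\zeta$ such that $L(P,\zeta)$ is defined for all $P\in\mathcal{P}$. An act $\zeta_P\in\mathcal{Z}$ is Bayes against $P$ if $E_P\{L(X,\zeta)-L(X,\zeta_P)\}\in[0,\infty]$ for all $\zeta\in\mathcal{Z}$. The generalized entropy is $H(P):=\inf_{a\in\mathcal{A}}L(P,a)$. Specific entropy: $h(\tau):=\sup_{P\in\Gamma_\tau}H(P)$ (with $h(\tau)=-\infty$ if $\Gamma_\tau=\varnothing$); $\mathcal{T}:=\{\tau\in\mathbb{R}^k:h(\tau)>-\infty\}$; $\mathcal{P}^*:=\{P\in\mathcal{P}:E_P(T)\in\mathcal{T}\}$. For $\tau\in\mathcal T$ and $\beta\in\mathbb{R}^k$, $\tau\leftrightarrow\beta$ means that there is a distribution in $\Gamma_\tau$ that attains both $\sup_{P\in\Gamma_\tau}H(P)$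 and $\sup_{P\in\mathcal{P}^*}\{H(P)-\beta^{\mathrm T}E_P(T)\}$, both suprema being finite. An act $\zeta\in\mathcal{Z}$ is an equalizer rule against $\Gamma_\tau$ (in $\mathcal{G}^\tau$) if $L(P,\zeta)$ is the same finite constant for all $P\in\Gamma_\tau$. A pair $(P^*,\zeta^* )\in\Gamma_\tau\times\mathcal{Z}$ is a saddle-point in $\mathcal{G}^\tau$ if $L(P^*,\zeta^* )$ is finite, $L(P^*,\zeta^* )\le L(P^*,\zeta)$ for all $\zeta\in\mathcal{Z}$, and $L(P^*,\zeta^* )\ge L(P,\zeta^* )$ for all $P\in\Gamma_\tau$. An act is robust Bayes against $\Gamma_\tau$ if it attains $\inf_{\zeta\in\mathcal{Z}}\sup_{P\in\Gamma_\tau}L(P,\zeta)$. *)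

theory Defs
  imports "HOL-Probability.Probability"
begin

text \<open>
  Expectation in the extended sense: \<open>E f = E f\<^sup>+ - E f\<^sup>-\<close>, where \<open>e2ennreal y\<close> is the positive
  part of \<open>y\<close>.  When both parts are infinite the expectation is undefined and the value of
  \<open>ext_expectation\<close> is meaningless, so \<open>ext_expectation_defined\<close> is required separately.
\<close>

definition ext_expectation :: "'b measure \<Rightarrow> ('b \<Rightarrow> ereal) \<Rightarrow> ereal" where
  "ext_expectation M f =
     enn2ereal (\<integral>\<^sup>+ x. e2ennreal (f x) \<partial>M) - enn2ereal (\<integral>\<^sup>+ x. e2ennreal (- f x) \<partial>M)"

definition ext_expectation_defined :: "'b measure \<Rightarrow> ('b \<Rightarrow> ereal) \<Rightarrow> bool" where
  "ext_expectation_defined M f \<longleftrightarrow>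
     \<not> ((\<integral>\<^sup>+ x. e2ennreal (f x) \<partial>M) = \<infinity> \<and> (\<integral>\<^sup>+ x. e2ennreal (- f x) \<partial>M) = \<infinity>)"

text \<open>Of the measures \<open>X\<close> and \<open>A\<close> only the underlying measurable spaces matter.\<close>

locale basic_game =
  fixes X :: "'x measure" and A :: "'a measure" and L :: "'x \<Rightarrow> 'a \<Rightarrow> ereal"
  assumes singleton_X: "x \<in> space X \<Longrightarrow> {x} \<in> sets X"
    and singleton_A: "a \<in> space A \<Longrightarrow> {a} \<in> sets A"
    and measurable_L: "(\<lambda>(x, a). L x a) \<in> borel_measurable (X \<Otimes>\<^sub>M A)"
    and L_not_MInf: "x \<in> space X \<Longrightarrow> a \<in> space A \<Longrightarrow> L x a \<noteq> -\<infinity>"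

definition loss_Pa :: "('x \<Rightarrow> 'a \<Rightarrow> ereal) \<Rightarrow> 'x measure \<Rightarrow> 'a \<Rightarrow> ereal" where
  "loss_Pa L P a = ext_expectation P (\<lambda>x. L x a)"

definition loss_xz :: "('x \<Rightarrow> 'a \<Rightarrow> ereal) \<Rightarrow> 'x \<Rightarrow> 'a measure \<Rightarrow> ereal" where
  "loss_xz L x \<zeta> = ext_expectation \<zeta> (\<lambda>a. L x a)"

definition loss_Pz :: "('x \<Rightarrow> 'a \<Rightarrow> ereal) \<Rightarrow> 'x measure \<Rightarrow> 'a measure \<Rightarrow> ereal" where
  "loss_Pz L P \<zeta> = ext_expectation (P \<Otimes>\<^sub>M \<zeta>) (\<lambda>(x, a). L x a)"

text \<open>\<open>space (prob_algebra M)\<close> consists of all probability measures on the \<open>\<sigma>\<close>-algebra of \<open>M\<close>.\<close>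

definition distributions ::
    "'x measure \<Rightarrow> 'a measure \<Rightarrow> ('x \<Rightarrow> 'a \<Rightarrow> ereal) \<Rightarrow> 'x measure set" where
  "distributions X A L =
     {P \<in> space (prob_algebra X). \<forall>a\<in>space A. ext_expectation_defined P (\<lambda>x. L x a)}"

definition randomized_acts ::
    "'x measure \<Rightarrow> 'a measure \<Rightarrow> ('x \<Rightarrow> 'a \<Rightarrow> ereal) \<Rightarrow> 'a measure set" where
  "randomized_acts X A L =
     {\<zeta> \<in> space (prob_algebra A).
        \<forall>P\<in>distributions X A L. ext_expectation_defined (P \<Otimes>\<^sub>M \<zeta>) (\<lambda>(x, a). L x a)}"

text \<open>
  \<open>E\<^sub>P{L(X,\<zeta>) - L(X,\<zeta>\<^sub>P)} \<in> [0,\<infinity>]\<close> is read as including that the expectation exists: the difference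
  is not of the form \<open>\<infinity> - \<infinity>\<close> or \<open>(-\<infinity>) - (-\<infinity>)\<close>, except on a \<open>P\<close>-null set, and its expectation is
  defined.
\<close>

definition bayes_act ::
    "'x measure \<Rightarrow> 'a measure \<Rightarrow> ('x \<Rightarrow> 'a \<Rightarrow> ereal) \<Rightarrow> 'x measure \<Rightarrow> 'a measure \<Rightarrow> bool" where
  "bayes_act X A L P \<zeta>P \<longleftrightarrow>
     \<zeta>P \<in> randomized_acts X A L \<and>
     (\<forall>\<zeta>\<in>randomized_acts X A L.
        (AE x in P. \<not> (\<bar>loss_xz L x \<zeta>\<bar> = \<infinity> \<and> loss_xz L x \<zeta> = loss_xz L x \<zeta>P)) \<and>
        ext_expectation_defined P (\<lambda>x. loss_xz L x \<zeta> - loss_xz L x \<zeta>P) \<and>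
        0 \<le> ext_expectation P (\<lambda>x. loss_xz L x \<zeta> - loss_xz L x \<zeta>P))"

definition gen_entropy :: "'a measure \<Rightarrow> ('x \<Rightarrow> 'a \<Rightarrow> ereal) \<Rightarrow> 'x measure \<Rightarrow> ereal" where
  "gen_entropy A L P = (INF a\<in>space A. loss_Pa L P a)"

text \<open>The condition \<open>E\<^sub>P(T) = \<tau>\<close> with \<open>\<tau> \<in> \<real>\<^sup>k\<close> includes that \<open>T\<close> is \<open>P\<close>-integrable.\<close>

definition mean_constraint ::
    "'x measure \<Rightarrow> 'a measure \<Rightarrow> ('x \<Rightarrow> 'a \<Rightarrow> ereal) \<Rightarrow> ('x \<Rightarrow> real ^ 'k) \<Rightarrow> real ^ 'k
      \<Rightarrow> 'x measure set" where
  "mean_constraint X A L t \<tau> =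
     {P \<in> distributions X A L. integrable P t \<and> (\<integral>x. t x \<partial>P) = \<tau>}"

text \<open>In \<open>ereal\<close> the supremum of the empty set is \<open>-\<infinity>\<close>, as wanted.\<close>

definition specific_entropy ::
    "'x measure \<Rightarrow> 'a measure \<Rightarrow> ('x \<Rightarrow> 'a \<Rightarrow> ereal) \<Rightarrow> ('x \<Rightarrow> real ^ 'k) \<Rightarrow> real ^ 'k \<Rightarrow> ereal" where
  "specific_entropy X A L t \<tau> = (SUP P\<in>mean_constraint X A L t \<tau>. gen_entropy A L P)"

definition entropy_domain ::
    "'x measure \<Rightarrow> 'a measure \<Rightarrow> ('x \<Rightarrow> 'a \<Rightarrow> ereal) \<Rightarrow> ('x \<Rightarrow> real ^ 'k) \<Rightarrow> (real ^ 'k) set" where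
  "entropy_domain X A L t = {\<tau>. specific_entropy X A L t \<tau> > -\<infinity>}"

definition domain_distributions ::
    "'x measure \<Rightarrow> 'a measure \<Rightarrow> ('x \<Rightarrow> 'a \<Rightarrow> ereal) \<Rightarrow> ('x \<Rightarrow> real ^ 'k) \<Rightarrow> 'x measure set" where
  "domain_distributions X A L t =
     {P \<in> distributions X A L. integrable P t \<and> (\<integral>x. t x \<partial>P) \<in> entropy_domain X A L t}"

definition attains_finite_sup :: "('b \<Rightarrow> ereal) \<Rightarrow> 'b set \<Rightarrow> 'b \<Rightarrow> bool" where
  "attains_finite_sup f S x \<longleftrightarrow> x \<in> S \<and> f x = (SUP y\<in>S. f y) \<and> \<bar>SUP y\<in>S. f y\<bar> \<noteq> \<infinity>"

definition corresponds ::
    "'x measure \<Rightarrow> 'a measure \<Rightarrow> ('x \<Rightarrow> 'a \<Rightarrow> ereal) \<Rightarrow> ('x \<Rightarrow> real ^ 'k) \<Rightarrow> real ^ 'k \<Rightarrow> real ^ 'k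
      \<Rightarrow> bool" where
  "corresponds X A L t \<tau> \<beta> \<longleftrightarrow>
     \<tau> \<in> entropy_domain X A L t \<and>
     (\<exists>P\<in>mean_constraint X A L t \<tau>.
        attains_finite_sup (gen_entropy A L) (mean_constraint X A L t \<tau>) P \<and>
        attains_finite_sup (\<lambda>Q. gen_entropy A L Q - ereal (\<beta> \<bullet> (\<integral>x. t x \<partial>Q)))
          (domain_distributions X A L t) P)"

definition equalizer_rule ::
    "'x measure \<Rightarrow> 'a measure \<Rightarrow> ('x \<Rightarrow> 'a \<Rightarrow> ereal) \<Rightarrow> 'x measure set \<Rightarrow> 'a measure \<Rightarrow> bool" where
  "equalizer_rule X A L \<Gamma> \<zeta> \<longleftrightarrow>
     \<zeta> \<in> randomized_acts X A L \<and> (\<exists>c::real. \<forall>P\<in>\<Gamma>. loss_Pz L P \<zeta> = ereal c)"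

definition saddle_point ::
    "'x measure \<Rightarrow> 'a measure \<Rightarrow> ('x \<Rightarrow> 'a \<Rightarrow> ereal) \<Rightarrow> 'x measure set \<Rightarrow> 'x measure \<Rightarrow> 'a measure
      \<Rightarrow> bool" where
  "saddle_point X A L \<Gamma> P \<zeta> \<longleftrightarrow>
     P \<in> \<Gamma> \<and> \<zeta> \<in> randomized_acts X A L \<and>
     \<bar>loss_Pz L P \<zeta>\<bar> \<noteq> \<infinity> \<and>
     (\<forall>\<zeta>'\<in>randomized_acts X A L. loss_Pz L P \<zeta> \<le> loss_Pz L P \<zeta>') \<and>
     (\<forall>P'\<in>\<Gamma>. loss_Pz L P' \<zeta> \<le> loss_Pz L P \<zeta>)"

definition robust_bayes ::
    "'x measure \<Rightarrow> 'a measure \<Rightarrow> ('x \<Rightarrow> 'a \<Rightarrow> ereal) \<Rightarrow> 'x measure set \<Rightarrow> 'a measure \<Rightarrow> bool" where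
  "robust_bayes X A L \<Gamma> \<zeta> \<longleftrightarrow>
     \<zeta> \<in> randomized_acts X A L \<and>
     (SUP P\<in>\<Gamma>. loss_Pz L P \<zeta>) = (INF \<zeta>'\<in>randomized_acts X A L. SUP P\<in>\<Gamma>. loss_Pz L P \<zeta>')"

definition linear_pair ::
    "'x measure \<Rightarrow> 'a measure \<Rightarrow> ('x \<Rightarrow> 'a \<Rightarrow> ereal) \<Rightarrow> ('x \<Rightarrow> real ^ 'k) \<Rightarrow> real ^ 'k
      \<Rightarrow> 'x measure \<Rightarrow> 'a measure \<Rightarrow> real \<Rightarrow> real ^ 'k \<Rightarrow> bool" where
  "linear_pair X A L t \<tau> P \<zeta> \<beta>0 \<beta> \<longleftrightarrow>
     P \<in> mean_constraint X A L t \<tau> \<and>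
     \<zeta> \<in> randomized_acts X A L \<and> bayes_act X A L P \<zeta> \<and>
     (\<forall>x\<in>space X. loss_xz L x \<zeta> = ereal (\<beta>0 + \<beta> \<bullet> t x))"

end

theory Submission
  imports Defs
begin

text \<open>
  Write \<open>g x = \<beta>\<^sub>0 + \<beta> \<bullet> t x\<close>.  For every \<open>P\<close> under which \<open>t\<close> is integrable, Fubini turns the
  linear form of \<open>L(x,\<zeta>\<^sub>\<tau>)\<close> into \<open>L(P,\<zeta>\<^sub>\<tau>) = E\<^sub>P(g)\<close>, which depends on \<open>P\<close> only through \<open>E\<^sub>P(T)\<close>.
  Since \<open>g\<close> is integrable, the Bayes property of \<open>\<zeta>\<^sub>\<tau>\<close> can be rewritten as
  \<open>L(P\<^sub>\<tau>,\<zeta>\<^sub>\<tau>) \<le> L(P\<^sub>\<tau>,\<zeta>)\<close> for all \<open>\<zeta>\<close>; taking point masses for \<open>\<zeta>\<close> gives \<open>L(P\<^sub>\<tau>,\<zeta>\<^sub>\<tau>) \<le> H(P\<^sub>\<tau>)\<close>.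
  Conversely \<open>H(P) \<le> L(P,\<zeta>\<^sub>\<tau>)\<close> always, as an average is at least the infimum.
\<close>

section \<open>Arithmetic of positive and negative parts of extended reals\<close>

lemma enn2ereal_e2ennreal_diff: "enn2ereal (e2ennreal y) - enn2ereal (e2ennreal (- y)) = y"
proof (cases "0 \<le> y")
  case True
  then show ?thesis by (simp add: enn2ereal_e2ennreal e2ennreal_neg zero_ennreal.rep_eq)
next
  case False
  then have "y \<le> 0" "0 \<le> - y" by (auto simp: ereal_0_le_uminus_iff)
  then show ?thesis by (simp add: enn2ereal_e2ennreal e2ennreal_neg zero_ennreal.rep_eq)
qed

text \<open>The case \<open>p = n = \<infinity>\<close> is covered too, because
  \<open>\<infinity> - \<infinity>\<close> evaluates to \<open>\<infinity>\<close> in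
  \<open>ereal\<close>. So a finite value of an extended expectation certifies that both of its
  parts are finite.\<close>

lemma enn2ereal_diff_finite:
  assumes "\<bar>enn2ereal p - enn2ereal n\<bar> \<noteq> \<infinity>"
  shows "p \<noteq> \<infinity>" "n \<noteq> \<infinity>"
  using assms by (cases p; cases n; auto simp: enn2ereal_ennreal)+

text \<open>Moves every negative term to the other side, splitting \<open>d\<close> into its own two
  parts, so that the inequality lives in \<open>ennreal\<close> and can be integrated by
  monotonicity. The next lemma reads the integrated inequality back in \<open>ereal\<close>.\<close>

lemma ereal_le_enn2ereal_diff_imp:
  assumes "ereal d \<le> enn2ereal p - enn2ereal n"
  shows "ennreal d + n \<le> p + ennreal (- d)"
  using assms
  by (cases p; cases n; cases "0 \<le> d")
     (auto simp: enn2ereal_ennreal ennreal_neg top_unique simp flip: ennreal_plus)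

lemma ennreal_le_imp_le_diff:
  assumes "ennreal d + n \<le> p + ennreal (- d)" "\<not> (p = \<infinity> \<and> n = \<infinity>)"
  shows "ereal d \<le> enn2ereal p - enn2ereal n"
  using assms
  by (cases p; cases n; cases "0 \<le> d")
     (auto simp: enn2ereal_ennreal ennreal_neg top_unique simp flip: ennreal_plus)

text \<open>Both sides are arranged so that no subtraction of extended reals occurs.\<close>

lemma pos_neg_parts_balance:
  fixes p n :: ennreal and g :: real
  assumes "\<not> (p = \<infinity> \<and> n = \<infinity>)"
  defines "f \<equiv> enn2ereal p - enn2ereal n"
  shows "e2ennreal (f - ereal g) + n + ennreal g = e2ennreal (- (f - ereal g)) + p + ennreal (- g)"
proof (cases p)
  case (real a)
  show ?thesis
  proof (cases n)
    case (real b)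
    have f: "f = ereal (a - b)"
      using \<open>p = ennreal a\<close> \<open>0 \<le> a\<close> real by (simp add: f_def enn2ereal_ennreal)
    \<comment> \<open>\<open>ennreal\<close> truncates negative numbers to 0, so each sign pattern
      leaves its own linear identity.\<close>
    consider "0 \<le> g" "0 \<le> a - b - g" | "0 \<le> g" "a - b - g \<le> 0"
      | "g \<le> 0" "0 \<le> a - b - g" | "g \<le> 0" "a - b - g \<le> 0" by linarith
    then show ?thesis
      using \<open>p = ennreal a\<close> \<open>0 \<le> a\<close> real
      by cases (auto simp: f e2ennreal_ereal ennreal_neg simp flip: ennreal_plus)
  next
    case top
    then show ?thesis using real by (simp add: f_def enn2ereal_ennreal e2ennreal_infty)
  qed
next
  case top
  then obtain b where "n = ennreal b" "0 \<le> b" using assms(1) by (cases n) auto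
  then show ?thesis using top by (simp add: f_def enn2ereal_ennreal)
qed

text \<open>Once integrated, this makes the positive part of the difference have a finite integral
  whenever \<open>p\<close> and the negative part of \<open>g\<close> do, which is what permits
  cancellation later.\<close>

lemma e2ennreal_diff_le:
  "e2ennreal (enn2ereal p - enn2ereal n - ereal g) \<le> p + ennreal (- g)"
proof (cases p)
  case (real a)
  show ?thesis
  proof (cases n)
    case (real b)
    have "ennreal (a - b - g) \<le> ennreal a + ennreal (- g)"
    proof -
      have "ennreal (a - b - g) \<le> ennreal (a + max 0 (- g))"
        using \<open>0 \<le> b\<close> by (intro ennreal_leI) auto
      also have "\<dots> = ennreal a + ennreal (- g)"
        using \<open>0 \<le> a\<close> by (simp add: ennreal_plus max_def ennreal_neg)
      finally show ?thesis .
    qed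
    then show ?thesis
      using \<open>p = ennreal a\<close> \<open>0 \<le> a\<close> real by (simp add: enn2ereal_ennreal e2ennreal_ereal)
  next
    case top
    then show ?thesis using real by (simp add: enn2ereal_ennreal e2ennreal_neg)
  qed
qed simp

section \<open>Extended expectations under point masses and of integrable functions\<close>

lemma ext_expectation_return:
  assumes "f \<in> borel_measurable M" "x \<in> space M"
  shows "ext_expectation (return M x) f = f x" "ext_expectation_defined (return M x) f"
proof -
  have *: "(\<integral>\<^sup>+ y. e2ennreal (f y) \<partial>return M x) = e2ennreal (f x)"
    "(\<integral>\<^sup>+ y. e2ennreal (- f y) \<partial>return M x) = e2ennreal (- f x)"
    using assms by (auto intro!: nn_integral_return)
  show "ext_expectation (return M x) f = f x"
    by (simp add: ext_expectation_def * enn2ereal_e2ennreal_diff)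
  show "ext_expectation_defined (return M x) f"
    unfolding ext_expectation_defined_def *
    by (cases "f x") (auto simp: e2ennreal_ereal e2ennreal_neg)
qed

text \<open>Names both part integrals as real numbers, so that balances between integrals can be
  solved by real arithmetic.\<close>

lemma integrable_parts:
  fixes g :: "'b \<Rightarrow> real"
  assumes "integrable P g"
  obtains a b where "0 \<le> a" "0 \<le> b" "(\<integral>\<^sup>+ x. ennreal (g x) \<partial>P) = ennreal a"
    "(\<integral>\<^sup>+ x. ennreal (- g x) \<partial>P) = ennreal b" "(\<integral>x. g x \<partial>P) = a - b"
proof -
  have "(\<integral>\<^sup>+ x. ennreal (g x) \<partial>P) \<noteq> \<infinity>" "(\<integral>\<^sup>+ x. ennreal (- g x) \<partial>P) \<noteq> \<infinity>"
    using assms by (auto simp: real_integrable_def)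
  moreover have "(\<integral>x. g x \<partial>P) = enn2real (\<integral>\<^sup>+ x. ennreal (g x) \<partial>P) - enn2real (\<integral>\<^sup>+ x. ennreal (- g x) \<partial>P)"
    using assms by (rule real_lebesgue_integral_def)
  ultimately show ?thesis
    by (intro that[of "enn2real (\<integral>\<^sup>+ x. ennreal (g x) \<partial>P)" "enn2real (\<integral>\<^sup>+ x. ennreal (- g x) \<partial>P)"])
       (auto simp: less_top)
qed

section \<open>Iterated integrals of the loss, and entropy as a lower bound for randomized
  acts\<close>

context basic_game
begin

text \<open>The \<open>\<zeta>\<close>-average of the positive part of \<open>L x\<close>, which in
  general is not the positive part of \<open>loss_xz L x \<zeta>\<close>. With
  \<open>neg_loss\<close> as its counterpart, averages stay in \<open>ennreal\<close>, where Tonelli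
  and additivity need no integrability.\<close>

definition pos_loss :: "'x \<Rightarrow> 'a measure \<Rightarrow> ennreal" where
  "pos_loss x \<zeta> = (\<integral>\<^sup>+ a. e2ennreal (L x a) \<partial>\<zeta>)"

definition neg_loss :: "'x \<Rightarrow> 'a measure \<Rightarrow> ennreal" where
  "neg_loss x \<zeta> = (\<integral>\<^sup>+ a. e2ennreal (- L x a) \<partial>\<zeta>)"

lemma loss_xz_eq: "loss_xz L x \<zeta> = enn2ereal (pos_loss x \<zeta>) - enn2ereal (neg_loss x \<zeta>)"
  by (simp add: loss_xz_def ext_expectation_def pos_loss_def neg_loss_def)

lemma measurable_L_pair [measurable]:
  assumes [measurable_cong]: "sets P = sets X" "sets \<zeta> = sets A"
  shows "(\<lambda>(x, a). L x a) \<in> borel_measurable (P \<Otimes>\<^sub>M \<zeta>)"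
proof -
  have "sets (P \<Otimes>\<^sub>M \<zeta>) = sets (X \<Otimes>\<^sub>M A)"
    using assms by (rule sets_pair_measure_cong)
  then show ?thesis using measurable_L measurable_cong_sets by blast
qed

lemma measurable_L_fst: "x \<in> space X \<Longrightarrow> L x \<in> borel_measurable A"
  using measurable_compose[OF measurable_Pair1' measurable_L] by simp

lemma measurable_L_snd: "a \<in> space A \<Longrightarrow> (\<lambda>x. L x a) \<in> borel_measurable X"
  using measurable_compose[OF measurable_Pair2' measurable_L] by simp

context
  fixes P :: "'x measure" and \<zeta> :: "'a measure"
  assumes P: "P \<in> space (prob_algebra X)" and \<zeta>: "\<zeta> \<in> space (prob_algebra A)"
begin

lemma sets_P [measurable_cong]: "sets P = sets X" and sets_\<zeta> [measurable_cong]: "sets \<zeta> = sets A"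
  using P \<zeta> by (auto simp: space_prob_algebra)

lemma prob_space_P: "prob_space P" and prob_space_\<zeta>: "prob_space \<zeta>"
  using P \<zeta> by (auto simp: space_prob_algebra)

lemma measurable_loss_parts [measurable]:
  "(\<lambda>x. pos_loss x \<zeta>) \<in> borel_measurable P" "(\<lambda>x. neg_loss x \<zeta>) \<in> borel_measurable P"
proof -
  interpret Z: prob_space \<zeta> by (rule prob_space_\<zeta>)
  note [measurable] = measurable_L_pair[OF sets_P sets_\<zeta>]
  show "(\<lambda>x. pos_loss x \<zeta>) \<in> borel_measurable P" "(\<lambda>x. neg_loss x \<zeta>) \<in> borel_measurable P"
    unfolding pos_loss_def neg_loss_def by measurable
qed

lemma pair_nn_integrals:
  "(\<integral>\<^sup>+ z. e2ennreal (case z of (x, a) \<Rightarrow> L x a) \<partial>(P \<Otimes>\<^sub>M \<zeta>)) = (\<integral>\<^sup>+ x. pos_loss x \<zeta> \<partial>P)"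
  "(\<integral>\<^sup>+ z. e2ennreal (- (case z of (x, a) \<Rightarrow> L x a)) \<partial>(P \<Otimes>\<^sub>M \<zeta>)) = (\<integral>\<^sup>+ x. neg_loss x \<zeta> \<partial>P)"
proof -
  interpret Z: prob_space \<zeta> by (rule prob_space_\<zeta>)
  note [measurable] = measurable_L_pair[OF sets_P sets_\<zeta>]
  show "(\<integral>\<^sup>+ z. e2ennreal (case z of (x, a) \<Rightarrow> L x a) \<partial>(P \<Otimes>\<^sub>M \<zeta>)) = (\<integral>\<^sup>+ x. pos_loss x \<zeta> \<partial>P)"
    "(\<integral>\<^sup>+ z. e2ennreal (- (case z of (x, a) \<Rightarrow> L x a)) \<partial>(P \<Otimes>\<^sub>M \<zeta>)) = (\<integral>\<^sup>+ x. neg_loss x \<zeta> \<partial>P)"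
    unfolding pos_loss_def neg_loss_def
    by (subst Z.nn_integral_fst[symmetric]; simp)+
qed

text \<open>The order with the \<open>P\<close>-integral inside is the one that involves
  \<open>loss_Pa\<close>, hence the entropy.\<close>

lemma pair_nn_integrals_swap:
  "(\<integral>\<^sup>+ a. (\<integral>\<^sup>+ x. e2ennreal (L x a) \<partial>P) \<partial>\<zeta>) = (\<integral>\<^sup>+ x. pos_loss x \<zeta> \<partial>P)"
  "(\<integral>\<^sup>+ a. (\<integral>\<^sup>+ x. e2ennreal (- L x a) \<partial>P) \<partial>\<zeta>) = (\<integral>\<^sup>+ x. neg_loss x \<zeta> \<partial>P)"
  "(\<lambda>a. \<integral>\<^sup>+ x. e2ennreal (L x a) \<partial>P) \<in> borel_measurable \<zeta>"
  "(\<lambda>a. \<integral>\<^sup>+ x. e2ennreal (- L x a) \<partial>P) \<in> borel_measurable \<zeta>"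
proof -
  interpret P: prob_space P by (rule prob_space_P)
  interpret Z: prob_space \<zeta> by (rule prob_space_\<zeta>)
  interpret PZ: pair_sigma_finite P \<zeta> ..
  note [measurable] = measurable_L_pair[OF sets_P sets_\<zeta>]
  show "(\<integral>\<^sup>+ a. (\<integral>\<^sup>+ x. e2ennreal (L x a) \<partial>P) \<partial>\<zeta>) = (\<integral>\<^sup>+ x. pos_loss x \<zeta> \<partial>P)"
    "(\<integral>\<^sup>+ a. (\<integral>\<^sup>+ x. e2ennreal (- L x a) \<partial>P) \<partial>\<zeta>) = (\<integral>\<^sup>+ x. neg_loss x \<zeta> \<partial>P)"
    unfolding pos_loss_def neg_loss_def by (rule PZ.Fubini'; measurable)+
  show "(\<lambda>a. \<integral>\<^sup>+ x. e2ennreal (L x a) \<partial>P) \<in> borel_measurable \<zeta>"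
    "(\<lambda>a. \<integral>\<^sup>+ x. e2ennreal (- L x a) \<partial>P) \<in> borel_measurable \<zeta>"
    by measurable
qed

lemma loss_Pz_eq:
  "loss_Pz L P \<zeta> = enn2ereal (\<integral>\<^sup>+ x. pos_loss x \<zeta> \<partial>P) - enn2ereal (\<integral>\<^sup>+ x. neg_loss x \<zeta> \<partial>P)"
  by (simp add: loss_Pz_def ext_expectation_def pair_nn_integrals)

lemma pair_defined_iff:
  "ext_expectation_defined (P \<Otimes>\<^sub>M \<zeta>) (\<lambda>(x, a). L x a) \<longleftrightarrow>
    \<not> ((\<integral>\<^sup>+ x. pos_loss x \<zeta> \<partial>P) = \<infinity> \<and> (\<integral>\<^sup>+ x. neg_loss x \<zeta> \<partial>P) = \<infinity>)"
  by (simp add: ext_expectation_defined_def pair_nn_integrals)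

lemma gen_entropy_le_loss_Pz:
  assumes "\<bar>loss_Pz L P \<zeta>\<bar> \<noteq> \<infinity>"
  shows "gen_entropy A L P \<le> loss_Pz L P \<zeta>"
proof (rule ccontr)
  interpret Z: prob_space \<zeta> by (rule prob_space_\<zeta>)
  note [measurable] = pair_nn_integrals_swap(3,4)
  let ?p = "\<lambda>a. \<integral>\<^sup>+ x. e2ennreal (L x a) \<partial>P" and ?n = "\<lambda>a. \<integral>\<^sup>+ x. e2ennreal (- L x a) \<partial>P"
  have fin: "\<not> ((\<integral>\<^sup>+ x. pos_loss x \<zeta> \<partial>P) = \<infinity> \<and> (\<integral>\<^sup>+ x. neg_loss x \<zeta> \<partial>P) = \<infinity>)"
    using enn2ereal_diff_finite(1)[OF assms[unfolded loss_Pz_eq]] by blast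
  assume "\<not> gen_entropy A L P \<le> loss_Pz L P \<zeta>"
  \<comment> \<open>The entropy may be \<open>\<infinity>\<close>; a real level strictly between the
    two values can be split into \<open>ennreal d\<close> and \<open>ennreal (- d)\<close>.\<close>
  then obtain d where d: "ereal d \<le> gen_entropy A L P" "\<not> ereal d \<le> loss_Pz L P \<zeta>"
    using ereal_dense2[of "loss_Pz L P \<zeta>" "gen_entropy A L P"] by (meson less_imp_le not_le)
  have "ennreal d + ?n a \<le> ?p a + ennreal (- d)" if "a \<in> space \<zeta>" for a
  proof (rule ereal_le_enn2ereal_diff_imp)
    have "a \<in> space A" using that sets_eq_imp_space_eq[OF sets_\<zeta>] by simp
    then have "gen_entropy A L P \<le> loss_Pa L P a"
      unfolding gen_entropy_def by (rule INF_lower)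
    with d(1) show "ereal d \<le> enn2ereal (?p a) - enn2ereal (?n a)"
      unfolding loss_Pa_def ext_expectation_def by (rule order_trans)
  qed
  then have "(\<integral>\<^sup>+ a. ennreal d + ?n a \<partial>\<zeta>) \<le> (\<integral>\<^sup>+ a. ?p a + ennreal (- d) \<partial>\<zeta>)"
    by (rule nn_integral_mono)
  \<comment> \<open>Since \<open>\<zeta>\<close> has mass one, the constants survive integration
    unchanged.\<close>
  then have "ennreal d + (\<integral>\<^sup>+ x. neg_loss x \<zeta> \<partial>P)
      \<le> (\<integral>\<^sup>+ x. pos_loss x \<zeta> \<partial>P) + ennreal (- d)"
    by (simp add: nn_integral_add pair_nn_integrals_swap(1,2) Z.emeasure_space_1)
  then have "ereal d \<le> loss_Pz L P \<zeta>"
    unfolding loss_Pz_eq using fin by (rule ennreal_le_imp_le_diff)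
  with d(2) show False ..
qed

end

section \<open>Point masses, and the loss compared with an integrable function\<close>

lemma return_in_distributions: "x \<in> space X \<Longrightarrow> return X x \<in> distributions X A L"
  by (auto simp: distributions_def space_prob_algebra prob_space_return
      intro!: ext_expectation_return measurable_L_snd)

text \<open>Embeds pure acts into the randomized ones, so that a bound over all randomized acts also
  bounds the infimum defining the entropy. Definedness of the loss of the point mass at
  \<open>a\<close> is exactly the condition that \<open>distributions\<close> imposes at
  \<open>a\<close>.\<close>

lemma return_act:
  assumes a: "a \<in> space A"
  shows "return A a \<in> randomized_acts X A L"
    and "P \<in> distributions X A L \<Longrightarrow> loss_Pz L P (return A a) = loss_Pa L P a"
proof -
  have ret: "return A a \<in> space (prob_algebra A)"
    using a by (simp add: space_prob_algebra prob_space_return)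
  have parts: "pos_loss x (return A a) = e2ennreal (L x a)"
      "neg_loss x (return A a) = e2ennreal (- L x a)" if "x \<in> space X" for x
    unfolding pos_loss_def neg_loss_def using a measurable_L_fst[OF that]
    by (auto intro!: nn_integral_return)
  have ints: "(\<integral>\<^sup>+ x. pos_loss x (return A a) \<partial>P) = (\<integral>\<^sup>+ x. e2ennreal (L x a) \<partial>P)"
      "(\<integral>\<^sup>+ x. neg_loss x (return A a) \<partial>P) = (\<integral>\<^sup>+ x. e2ennreal (- L x a) \<partial>P)"
    if "P \<in> distributions X A L" for P
  proof -
    have "space P = space X"
      using that by (auto simp: distributions_def space_prob_algebra dest: sets_eq_imp_space_eq)
    then show "(\<integral>\<^sup>+ x. pos_loss x (return A a) \<partial>P) = (\<integral>\<^sup>+ x. e2ennreal (L x a) \<partial>P)"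
      "(\<integral>\<^sup>+ x. neg_loss x (return A a) \<partial>P) = (\<integral>\<^sup>+ x. e2ennreal (- L x a) \<partial>P)"
      by (auto intro!: nn_integral_cong simp: parts)
  qed
  have prob: "P \<in> space (prob_algebra X)" if "P \<in> distributions X A L" for P
    using that by (simp add: distributions_def)
  show "return A a \<in> randomized_acts X A L"
    unfolding randomized_acts_def
  proof (intro CollectI conjI ballI ret)
    fix P assume P: "P \<in> distributions X A L"
    then have "ext_expectation_defined P (\<lambda>x. L x a)" using a by (simp add: distributions_def)
    then show "ext_expectation_defined (P \<Otimes>\<^sub>M return A a) (\<lambda>(x, a). L x a)"
      unfolding pair_defined_iff[OF prob[OF P] ret] ints[OF P] by (simp add: ext_expectation_defined_def)
  qed
  show "loss_Pz L P (return A a) = loss_Pa L P a" if "P \<in> distributions X A L"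
    unfolding loss_Pz_eq[OF prob[OF that] ret] ints[OF that] by (simp add: loss_Pa_def ext_expectation_def)
qed

lemma randomized_act_parts_defined:
  assumes "\<zeta> \<in> randomized_acts X A L" "x \<in> space X"
  shows "\<not> (pos_loss x \<zeta> = \<infinity> \<and> neg_loss x \<zeta> = \<infinity>)"
proof -
  have \<zeta>: "\<zeta> \<in> space (prob_algebra A)" using assms(1) by (simp add: randomized_acts_def)
  \<comment> \<open>the point mass at \<open>x\<close> turns definedness of \<open>L(P,\<zeta>)\<close> for all \<open>P\<close> into a pointwise statement\<close>
  have r: "return X x \<in> distributions X A L" by (rule return_in_distributions[OF assms(2)])
  then have rp: "return X x \<in> space (prob_algebra X)" by (simp add: distributions_def)
  have [measurable]: "(\<lambda>x. pos_loss x \<zeta>) \<in> borel_measurable X" "(\<lambda>x. neg_loss x \<zeta>) \<in> borel_measurable X"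
    using measurable_loss_parts[OF rp \<zeta>] by simp_all
  have "ext_expectation_defined (return X x \<Otimes>\<^sub>M \<zeta>) (\<lambda>(x, a). L x a)"
    using assms(1) r by (simp add: randomized_acts_def)
  then show ?thesis
    unfolding pair_defined_iff[OF rp \<zeta>] using assms(2) by (simp add: nn_integral_return)
qed

text \<open>Integrates \<open>pos_neg_parts_balance\<close> and \<open>e2ennreal_diff_le\<close>
  over \<open>P\<close>. Both are additive statements in \<open>ennreal\<close>, so they integrate
  termwise even when some integrals are infinite; \<open>randomized_act_parts_defined\<close>
  supplies the side condition of the first at every point.\<close>

lemma integrated_balance:
  fixes g :: "'x \<Rightarrow> real"
  assumes P: "P \<in> distributions X A L" and \<zeta>: "\<zeta> \<in> randomized_acts X A L"
    and g: "integrable P g"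
  defines "f \<equiv> \<lambda>x. loss_xz L x \<zeta> - ereal (g x)"
  shows "(\<integral>\<^sup>+ x. e2ennreal (f x) \<partial>P) + (\<integral>\<^sup>+ x. neg_loss x \<zeta> \<partial>P) + (\<integral>\<^sup>+ x. ennreal (g x) \<partial>P)
    = (\<integral>\<^sup>+ x. e2ennreal (- f x) \<partial>P) + (\<integral>\<^sup>+ x. pos_loss x \<zeta> \<partial>P) + (\<integral>\<^sup>+ x. ennreal (- g x) \<partial>P)"
    and "(\<integral>\<^sup>+ x. e2ennreal (f x) \<partial>P)
      \<le> (\<integral>\<^sup>+ x. pos_loss x \<zeta> \<partial>P) + (\<integral>\<^sup>+ x. ennreal (- g x) \<partial>P)"
proof -
  have pP: "P \<in> space (prob_algebra X)" and pZ: "\<zeta> \<in> space (prob_algebra A)"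
    using P \<zeta> by (simp_all add: distributions_def randomized_acts_def)
  note [measurable] = measurable_loss_parts[OF pP pZ] borel_measurable_integrable[OF g]
  have sp: "space P = space X"
    using pP by (auto simp: space_prob_algebra dest: sets_eq_imp_space_eq)
  have [measurable]: "f \<in> borel_measurable P"
    unfolding f_def loss_xz_eq by measurable
  have "(\<integral>\<^sup>+ x. e2ennreal (f x) + neg_loss x \<zeta> + ennreal (g x) \<partial>P)
    = (\<integral>\<^sup>+ x. e2ennreal (- f x) + pos_loss x \<zeta> + ennreal (- g x) \<partial>P)"
    unfolding f_def loss_xz_eq using randomized_act_parts_defined[OF \<zeta>] sp
    by (intro nn_integral_cong pos_neg_parts_balance) auto
  then show "(\<integral>\<^sup>+ x. e2ennreal (f x) \<partial>P) + (\<integral>\<^sup>+ x. neg_loss x \<zeta> \<partial>P) + (\<integral>\<^sup>+ x. ennreal (g x) \<partial>P)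
    = (\<integral>\<^sup>+ x. e2ennreal (- f x) \<partial>P) + (\<integral>\<^sup>+ x. pos_loss x \<zeta> \<partial>P) + (\<integral>\<^sup>+ x. ennreal (- g x) \<partial>P)"
    by (simp add: nn_integral_add)
  have "(\<integral>\<^sup>+ x. e2ennreal (f x) \<partial>P) \<le> (\<integral>\<^sup>+ x. pos_loss x \<zeta> + ennreal (- g x) \<partial>P)"
    unfolding f_def loss_xz_eq by (intro nn_integral_mono e2ennreal_diff_le)
  then show "(\<integral>\<^sup>+ x. e2ennreal (f x) \<partial>P)
      \<le> (\<integral>\<^sup>+ x. pos_loss x \<zeta> \<partial>P) + (\<integral>\<^sup>+ x. ennreal (- g x) \<partial>P)"
    by (simp add: nn_integral_add)
qed

text \<open>Here \<open>loss_xz L x \<zeta> - g x\<close> vanishes on the space, so the balance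
  reduces to one between the parts of the loss and the parts of \<open>g\<close>.\<close>

lemma loss_Pz_eq_integral:
  fixes g :: "'x \<Rightarrow> real"
  assumes P: "P \<in> distributions X A L" and \<zeta>: "\<zeta> \<in> randomized_acts X A L"
    and g: "integrable P g" and eq: "\<And>x. x \<in> space X \<Longrightarrow> loss_xz L x \<zeta> = ereal (g x)"
  shows "loss_Pz L P \<zeta> = ereal (\<integral>x. g x \<partial>P)"
proof -
  have pP: "P \<in> space (prob_algebra X)" and pZ: "\<zeta> \<in> space (prob_algebra A)"
    using P \<zeta> by (simp_all add: distributions_def randomized_acts_def)
  have sp: "space P = space X"
    using pP by (auto simp: space_prob_algebra dest: sets_eq_imp_space_eq)
  let ?p = "\<integral>\<^sup>+ x. pos_loss x \<zeta> \<partial>P" and ?n = "\<integral>\<^sup>+ x. neg_loss x \<zeta> \<partial>P"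
  \<comment> \<open>The right-hand sides are kept as integrals of 0 so that congruence applies: the
    integrands vanish only on \<open>space P\<close>.\<close>
  have zero: "(\<integral>\<^sup>+ x. e2ennreal (loss_xz L x \<zeta> - ereal (g x)) \<partial>P) = (\<integral>\<^sup>+ x. 0 \<partial>P)"
    "(\<integral>\<^sup>+ x. e2ennreal (- (loss_xz L x \<zeta> - ereal (g x))) \<partial>P) = (\<integral>\<^sup>+ x. 0 \<partial>P)"
    by (intro nn_integral_cong; simp add: eq sp e2ennreal_neg)+
  obtain a b where ab: "0 \<le> a" "0 \<le> b" "(\<integral>\<^sup>+ x. ennreal (g x) \<partial>P) = ennreal a"
    "(\<integral>\<^sup>+ x. ennreal (- g x) \<partial>P) = ennreal b" "(\<integral>x. g x \<partial>P) = a - b"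
    using integrable_parts[OF g] .
  have "?n + ennreal a = ?p + ennreal b"
    using integrated_balance(1)[OF P \<zeta> g] by (simp add: zero[simplified] ab(3,4))
  \<comment> \<open>This excludes the solution \<open>\<infinity> = \<infinity>\<close> of the
    balance; both parts are then finite and their difference is \<open>a - b\<close>.\<close>
  moreover have "\<not> (?p = \<infinity> \<and> ?n = \<infinity>)"
    using P \<zeta> pair_defined_iff[OF pP pZ] by (simp add: randomized_acts_def)
  ultimately show ?thesis
    unfolding loss_Pz_eq[OF pP pZ] ab(5) using ab(1,2)
    by (cases ?p; cases ?n) (auto simp: enn2ereal_ennreal simp flip: ennreal_plus)
qed

text \<open>Turns the Bayes condition, which concerns the expectation of a difference, into an
  inequality between expectations. When all parts are finite, the balance says that the loss exceeds
  the integral of \<open>g\<close> by exactly the expectation of the difference.\<close>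

lemma integral_le_loss_Pz:
  fixes g :: "'x \<Rightarrow> real"
  assumes P: "P \<in> distributions X A L" and \<zeta>: "\<zeta> \<in> randomized_acts X A L"
    and g: "integrable P g" and nonneg: "0 \<le> ext_expectation P (\<lambda>x. loss_xz L x \<zeta> - ereal (g x))"
  shows "ereal (\<integral>x. g x \<partial>P) \<le> loss_Pz L P \<zeta>"
proof -
  have pP: "P \<in> space (prob_algebra X)" and pZ: "\<zeta> \<in> space (prob_algebra A)"
    using P \<zeta> by (simp_all add: distributions_def randomized_acts_def)
  let ?p = "\<integral>\<^sup>+ x. pos_loss x \<zeta> \<partial>P" and ?n = "\<integral>\<^sup>+ x. neg_loss x \<zeta> \<partial>P"
  let ?fp = "\<integral>\<^sup>+ x. e2ennreal (loss_xz L x \<zeta> - ereal (g x)) \<partial>P"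
  let ?fn = "\<integral>\<^sup>+ x. e2ennreal (- (loss_xz L x \<zeta> - ereal (g x))) \<partial>P"
  obtain a b where ab: "0 \<le> a" "0 \<le> b" "(\<integral>\<^sup>+ x. ennreal (g x) \<partial>P) = ennreal a"
    "(\<integral>\<^sup>+ x. ennreal (- g x) \<partial>P) = ennreal b" "(\<integral>x. g x \<partial>P) = a - b"
    using integrable_parts[OF g] .
  have bal: "?fp + ?n + ennreal a = ?fn + ?p + ennreal b"
    using integrated_balance(1)[OF P \<zeta> g] by (simp only: ab(3,4))
  have le: "?fp \<le> ?p + ennreal b"
    using integrated_balance(2)[OF P \<zeta> g] by (simp only: ab(3,4))
  have nn: "0 \<le> enn2ereal ?fp - enn2ereal ?fn"
    using nonneg by (simp only: ext_expectation_def)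
  show ?thesis
  proof (cases ?p)
    case top
    \<comment> \<open>In \<open>ereal\<close>, \<open>\<infinity>\<close> minus anything is
      \<open>\<infinity>\<close>, so the bound is trivial.\<close>
    then show ?thesis by (simp add: loss_Pz_eq[OF pP pZ])
  next
    case (real p)
    then obtain u where u: "?fp = ennreal u" "0 \<le> u"
      using le ab(2) by (cases ?fp) (auto simp: top_unique simp flip: ennreal_plus)
    \<comment> \<open>An infinite \<open>?fn\<close> next to a finite \<open>?fp\<close> would make
      the difference \<open>-\<infinity>\<close>, against nonnegativity.\<close>
    then obtain v where v: "?fn = ennreal v" "0 \<le> v" "v \<le> u"
      using nn by (cases ?fn) (auto simp: enn2ereal_ennreal)
    have fin: "?fn + ?p + ennreal b = ennreal (v + p + b)"
      using v real ab by simp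
    then obtain n where n: "?n = ennreal n" "0 \<le> n"
      using bal by (cases ?n) auto
    have "u + n + a = v + p + b"
      using bal u n ab v real unfolding fin by (simp flip: ennreal_plus)
    then show ?thesis
      using real n v by (simp add: loss_Pz_eq[OF pP pZ] enn2ereal_ennreal ab(5))
  qed
qed

end

section \<open>Saddle point, entropy value and supporting slope of a linear pair\<close>

theorem theorem7p1:
  fixes X :: "'x measure" and A :: "'a measure" and L :: "'x \<Rightarrow> 'a \<Rightarrow> ereal"
    and t :: "'x \<Rightarrow> real ^ 'k" and \<tau> \<beta> :: "real ^ 'k" and \<beta>0 :: real
    and P\<tau> :: "'x measure" and \<zeta>\<tau> :: "'a measure"
  assumes "basic_game X A L"
    and "t \<in> borel_measurable X"
    and "\<tau> \<in> entropy_domain X A L t"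
    and "linear_pair X A L t \<tau> P\<tau> \<zeta>\<tau> \<beta>0 \<beta>"
  shows "equalizer_rule X A L (mean_constraint X A L t \<tau>) \<zeta>\<tau>
    \<and> saddle_point X A L (mean_constraint X A L t \<tau>) P\<tau> \<zeta>\<tau>
    \<and> robust_bayes X A L (mean_constraint X A L t \<tau>) \<zeta>\<tau>
    \<and> (specific_entropy X A L t \<tau> = gen_entropy A L P\<tau>
        \<and> gen_entropy A L P\<tau> = ereal (\<beta>0 + \<beta> \<bullet> \<tau>))
    \<and> corresponds X A L t \<tau> \<beta>"
proof -
  interpret basic_game X A L by (rule assms(1))
  let ?\<Gamma> = "mean_constraint X A L t \<tau>" and ?Z = "randomized_acts X A L"
  let ?g = "\<lambda>x. \<beta>0 + \<beta> \<bullet> t x" and ?c = "ereal (\<beta>0 + \<beta> \<bullet> \<tau>)"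
  have P\<tau>: "P\<tau> \<in> ?\<Gamma>" and \<zeta>\<tau>: "\<zeta>\<tau> \<in> ?Z" and bayes: "bayes_act X A L P\<tau> \<zeta>\<tau>"
    and lin: "\<And>x. x \<in> space X \<Longrightarrow> loss_xz L x \<zeta>\<tau> = ereal (?g x)"
    using assms(4) by (auto simp: linear_pair_def)
  have \<zeta>p: "\<zeta>\<tau> \<in> space (prob_algebra A)" using \<zeta>\<tau> by (simp add: randomized_acts_def)
  have g: "integrable P ?g" "(\<integral>x. ?g x \<partial>P) = \<beta>0 + \<beta> \<bullet> (\<integral>x. t x \<partial>P)"
    if "P \<in> distributions X A L" "integrable P t" for P
  proof -
    interpret P: prob_space P
      using that by (simp add: distributions_def space_prob_algebra)
    show "integrable P ?g" using that(2) by simp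
    show "(\<integral>x. ?g x \<partial>P) = \<beta>0 + \<beta> \<bullet> (\<integral>x. t x \<partial>P)" using that(2) by (simp add: P.prob_space)
  qed
  have loss: "loss_Pz L P \<zeta>\<tau> = ereal (\<beta>0 + \<beta> \<bullet> (\<integral>x. t x \<partial>P))"
    if "P \<in> distributions X A L" "integrable P t" for P
    using loss_Pz_eq_integral[OF that(1) \<zeta>\<tau> g(1)[OF that] lin] g(2)[OF that] by simp
  have H_le: "gen_entropy A L P \<le> ereal (\<beta>0 + \<beta> \<bullet> (\<integral>x. t x \<partial>P))"
    if "P \<in> distributions X A L" "integrable P t" for P
    using gen_entropy_le_loss_Pz[OF _ \<zeta>p, of P] that(1) unfolding loss[OF that]
    by (simp add: distributions_def)
  have \<Gamma>: "P \<in> distributions X A L" "integrable P t" "(\<integral>x. t x \<partial>P) = \<tau>" if "P \<in> ?\<Gamma>" for P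
    using that by (auto simp: mean_constraint_def)
  have loss_\<Gamma>: "loss_Pz L P \<zeta>\<tau> = ?c" if "P \<in> ?\<Gamma>" for P
    using loss[OF \<Gamma>(1,2)[OF that]] \<Gamma>(3)[OF that] by simp
  have H_le_\<Gamma>: "gen_entropy A L P \<le> ?c" if "P \<in> ?\<Gamma>" for P
    using H_le[OF \<Gamma>(1,2)[OF that]] \<Gamma>(3)[OF that] by simp
  have c_le: "?c \<le> loss_Pz L P\<tau> \<zeta>" if \<zeta>: "\<zeta> \<in> ?Z" for \<zeta>
  proof -
    note P = \<Gamma>(1,2)[OF P\<tau>]
    have sp: "space P\<tau> = space X"
      using P(1) by (auto simp: distributions_def space_prob_algebra dest: sets_eq_imp_space_eq)
    \<comment> \<open>The linear form holds only on \<open>space X\<close>, hence the replacement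
      under the integrals rather than by rewriting the function.\<close>
    have "ext_expectation P\<tau> (\<lambda>x. loss_xz L x \<zeta> - loss_xz L x \<zeta>\<tau>)
        = ext_expectation P\<tau> (\<lambda>x. loss_xz L x \<zeta> - ereal (?g x))"
      unfolding ext_expectation_def
      by (intro arg_cong2[where f = "(-)"] arg_cong[where f = enn2ereal] nn_integral_cong)
         (simp_all add: sp lin)
    moreover have "0 \<le> ext_expectation P\<tau> (\<lambda>x. loss_xz L x \<zeta> - loss_xz L x \<zeta>\<tau>)"
      using bayes \<zeta> by (simp add: bayes_act_def)
    ultimately have "ereal (\<integral>x. ?g x \<partial>P\<tau>) \<le> loss_Pz L P\<tau> \<zeta>"
      by (intro integral_le_loss_Pz[OF P(1) \<zeta> g(1)[OF P]]) simp
    then show ?thesis by (simp add: g(2)[OF P] \<Gamma>(3)[OF P\<tau>])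
  qed
  have H: "gen_entropy A L P\<tau> = ?c"
  proof (rule antisym[OF H_le_\<Gamma>[OF P\<tau>]])
    show "?c \<le> gen_entropy A L P\<tau>"
      unfolding gen_entropy_def
      using c_le[OF return_act(1)] return_act(2)[OF _ \<Gamma>(1)[OF P\<tau>]] by (auto intro!: INF_greatest)
  qed
  have h: "specific_entropy X A L t \<tau> = ?c"
    unfolding specific_entropy_def
    using H_le_\<Gamma> H P\<tau> by (intro SUP_eqI) force+

  have equalizer: "equalizer_rule X A L ?\<Gamma> \<zeta>\<tau>"
    using \<zeta>\<tau> loss_\<Gamma> by (auto simp: equalizer_rule_def)
  have saddle: "saddle_point X A L ?\<Gamma> P\<tau> \<zeta>\<tau>"
    using P\<tau> \<zeta>\<tau> c_le loss_\<Gamma> by (auto simp: saddle_point_def)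
  have robust: "robust_bayes X A L ?\<Gamma> \<zeta>\<tau>"
  proof -
    \<comment> \<open>The loss is constant on a set that is nonempty because it contains
      \<open>P\<tau>\<close>.\<close>
    have sup: "(SUP P\<in>?\<Gamma>. loss_Pz L P \<zeta>\<tau>) = ?c"
      using P\<tau> loss_\<Gamma> by (intro SUP_eqI) auto
    have "(INF \<zeta>\<in>?Z. SUP P\<in>?\<Gamma>. loss_Pz L P \<zeta>) = ?c"
    proof (rule antisym)
      show "(INF \<zeta>\<in>?Z. SUP P\<in>?\<Gamma>. loss_Pz L P \<zeta>) \<le> ?c"
        using INF_lower[OF \<zeta>\<tau>, of "\<lambda>\<zeta>. SUP P\<in>?\<Gamma>. loss_Pz L P \<zeta>"] sup by simp
      show "?c \<le> (INF \<zeta>\<in>?Z. SUP P\<in>?\<Gamma>. loss_Pz L P \<zeta>)"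
        \<comment> \<open>Against any act, the single distribution \<open>P\<tau>\<close> already
          forces a loss of at least \<open>?c\<close>.\<close>
        by (intro INF_greatest SUP_upper2[OF P\<tau>] c_le)
    qed
    then show ?thesis using \<zeta>\<tau> sup by (simp add: robust_bayes_def)
  qed
  have "corresponds X A L t \<tau> \<beta>"
    unfolding corresponds_def
  proof (intro conjI bexI[OF _ P\<tau>] assms(3))
    show "attains_finite_sup (gen_entropy A L) ?\<Gamma> P\<tau>"
      using P\<tau> H h by (simp add: attains_finite_sup_def specific_entropy_def)
    let ?D = "domain_distributions X A L t"
    let ?F = "\<lambda>Q. gen_entropy A L Q - ereal (\<beta> \<bullet> (\<integral>x. t x \<partial>Q))"
    have mem: "P\<tau> \<in> ?D"
      using \<Gamma>[OF P\<tau>] assms(3) by (simp add: domain_distributions_def)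
    have F: "?F P\<tau> = ereal \<beta>0"
      using H \<Gamma>(3)[OF P\<tau>] by simp
    \<comment> \<open>\<open>H_le\<close> is available for every mean of \<open>t\<close>, not only
      \<open>\<tau>\<close>. Subtracting
      \<open>\<beta> \<bullet> (\<integral>x. t x \<partial>Q)\<close> removes the dependence of its
      bound on \<open>Q\<close> and leaves \<open>\<beta>0\<close>, which \<open>P\<tau>\<close>
      attains. The case split handles infinite entropies.\<close>
    have "?F Q \<le> ereal \<beta>0" if "Q \<in> ?D" for Q
      using H_le[of Q] that
      by (cases "gen_entropy A L Q") (auto simp: domain_distributions_def)
    then have "(SUP Q\<in>?D. ?F Q) = ereal \<beta>0"
      using F mem by (intro SUP_eqI) force+
    then show "attains_finite_sup ?F ?D P\<tau>"
      using mem F by (simp add: attains_finite_sup_def)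
  qed
  with equalizer saddle robust show ?thesis
    using H h by simp
qed

end
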